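(* Let $(X,\tau)$ be a metrizable space, let $F=\{a_1,\dots,a_k\}\subseteq X$ be a set of $k$ distinct points with $2\le k<\infty$, and let $r=(r_1,\dots,r_k)$ be any $k$-tuple of $\tau$-continuous functions $r_i:X\to[0,1]$ with $r_i^{-1}(0)=\{a_i\}$ for $i=1,\dots,k$. Let $\nu_r$ be its gauge topology. Then the following are equivalent: (i) $r$ is compatible, i.e. $\inf_{x\in X}\max\{r_i(x),r_j(x)\}>0$ for all $i\ne j$; (ii) $\nu_r$ is Hausdorff; (iii) $\nu_r$ is metrizable. When these conditions hold, for any metric $d\le1$ on $X$ inducing $\tau$, the formula $$\rho_r(x,y)=\kappa(U_r(x),U_r(y))+\min\{H(U_r(x)),H(U_r(y))\}\,d(x,y)$$ defines a metric on $X$ that induces $\nu_r$.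
   Context: The gauge topology $\nu_r$ is defined by declaring $U\subseteq X$ open exactly when $U\in\tau$ and, for every $i$ with $a_i\in U$, there is $\varepsilon_i>0$ such that $\{x:r_i(x)<\varepsilon_i\}\subseteq U$ (no compatibility of $r$ is needed for this definition). $\Delta^{k-1}=\{p\in[0,1]^k:\sum_i p_i=1\}$ is the standard simplex, $\kappa(p,t)=\frac12\sum_{i=1}^k|p_i-t_i|$ and $H(p)=1-\max_{1\le i\le k}p_i$ for $p,t\in\Delta^{k-1}$. Put $P_i(x)=\prod_{j\ne i}r_j(x)$, $u_i(x)=P_i(x)/\sum_{\ell=1}^kP_\ell(x)$ (the denominator is always positive), and $U_r(x)=(u_1(x),\dots,u_k(x))\in\Delta^{k-1}$. *)

theory Defs
  imports "HOL-Analysis.Analysis"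
begin

text \<open>
  Indices range over \<open>{1..k}\<close>; points of the simplex (and \<open>k\<close>-tuples in general) are functions on
  \<open>nat\<close> of which only the values on \<open>{1..k}\<close> matter.
\<close>

definition gauge_open ::
    "'a topology \<Rightarrow> nat \<Rightarrow> (nat \<Rightarrow> 'a) \<Rightarrow> (nat \<Rightarrow> 'a \<Rightarrow> real) \<Rightarrow> 'a set \<Rightarrow> bool" where
  "gauge_open X k a r U \<longleftrightarrow> openin X U \<and>
     (\<forall>i\<in>{1..k}. a i \<in> U \<longrightarrow> (\<exists>\<epsilon>>0. {x \<in> topspace X. r i x < \<epsilon>} \<subseteq> U))"

definition gauge_topology ::
    "'a topology \<Rightarrow> nat \<Rightarrow> (nat \<Rightarrow> 'a) \<Rightarrow> (nat \<Rightarrow> 'a \<Rightarrow> real) \<Rightarrow> 'a topology" where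
  "gauge_topology X k a r = topology (gauge_open X k a r)"

lemma istopology_gauge_open: "istopology (gauge_open X k a r)"
  unfolding istopology_def
proof (intro conjI allI impI)
  fix S T assume S: "gauge_open X k a r S" and T: "gauge_open X k a r T"
  show "gauge_open X k a r (S \<inter> T)"
    unfolding gauge_open_def
  proof (intro conjI ballI impI)
    show "openin X (S \<inter> T)"
      using S T by (auto simp: gauge_open_def)
    fix i assume i: "i \<in> {1..k}" "a i \<in> S \<inter> T"
    obtain e where e: "e > 0" "{x \<in> topspace X. r i x < e} \<subseteq> S"
      using S i unfolding gauge_open_def by blast
    obtain e' where e': "e' > 0" "{x \<in> topspace X. r i x < e'} \<subseteq> T"
      using T i unfolding gauge_open_def by blast
    have "{x \<in> topspace X. r i x < min e e'} \<subseteq> S \<inter> T"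
      using e(2) e'(2) by auto
    then show "\<exists>\<epsilon>>0. {x \<in> topspace X. r i x < \<epsilon>} \<subseteq> S \<inter> T"
      using e(1) e'(1) by (intro exI[of _ "min e e'"]) simp
  qed
next
  fix \<K> assume K: "\<forall>S\<in>\<K>. gauge_open X k a r S"
  show "gauge_open X k a r (\<Union>\<K>)"
    unfolding gauge_open_def
  proof (intro conjI ballI impI)
    show "openin X (\<Union>\<K>)"
      using K by (auto simp: gauge_open_def)
    fix i assume i: "i \<in> {1..k}" "a i \<in> \<Union>\<K>"
    then obtain S where S: "S \<in> \<K>" "a i \<in> S" by blast
    then obtain e where "e > 0" "{x \<in> topspace X. r i x < e} \<subseteq> S"
      using K i unfolding gauge_open_def by blast
    then show "\<exists>\<epsilon>>0. {x \<in> topspace X. r i x < \<epsilon>} \<subseteq> \<Union>\<K>"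
      using S by blast
  qed
qed

lemma openin_gauge_topology: "openin (gauge_topology X k a r) U \<longleftrightarrow> gauge_open X k a r U"
  by (simp add: gauge_topology_def istopology_gauge_open topology_inverse')

definition gauge_compatible :: "'a topology \<Rightarrow> nat \<Rightarrow> (nat \<Rightarrow> 'a \<Rightarrow> real) \<Rightarrow> bool" where
  "gauge_compatible X k r \<longleftrightarrow>
     (\<forall>i\<in>{1..k}. \<forall>j\<in>{1..k}. i \<noteq> j \<longrightarrow> (INF x\<in>topspace X. max (r i x) (r j x)) > 0)"

definition simplex_dist :: "nat \<Rightarrow> (nat \<Rightarrow> real) \<Rightarrow> (nat \<Rightarrow> real) \<Rightarrow> real" where
  "simplex_dist k p t = 1/2 * (\<Sum>i=1..k. \<bar>p i - t i\<bar>)"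

definition simplex_height :: "nat \<Rightarrow> (nat \<Rightarrow> real) \<Rightarrow> real" where
  "simplex_height k p = 1 - Max (p ` {1..k})"

definition gauge_prod :: "nat \<Rightarrow> (nat \<Rightarrow> 'a \<Rightarrow> real) \<Rightarrow> nat \<Rightarrow> 'a \<Rightarrow> real" where
  "gauge_prod k r i x = (\<Prod>j\<in>{1..k} - {i}. r j x)"

definition gauge_coords :: "nat \<Rightarrow> (nat \<Rightarrow> 'a \<Rightarrow> real) \<Rightarrow> 'a \<Rightarrow> nat \<Rightarrow> real" where
  "gauge_coords k r x = (\<lambda>i. gauge_prod k r i x / (\<Sum>l=1..k. gauge_prod k r l x))"

text \<open>
  \<open>Metric_space M d\<close> demands nonnegativity and symmetry of \<open>d\<close> on the whole type, not just on the
  carrier. Outside \<open>topspace X\<close> the functions \<open>r i\<close> are arbitrary, so the formula for the metric could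
  become negative there; it is therefore set to 0 off the carrier.
\<close>

definition gauge_metric ::
    "'a topology \<Rightarrow> nat \<Rightarrow> (nat \<Rightarrow> 'a \<Rightarrow> real) \<Rightarrow> ('a \<Rightarrow> 'a \<Rightarrow> real) \<Rightarrow> 'a \<Rightarrow> 'a \<Rightarrow> real" where
  "gauge_metric X k r d x y =
     (if x \<in> topspace X \<and> y \<in> topspace X
      then simplex_dist k (gauge_coords k r x) (gauge_coords k r y)
           + min (simplex_height k (gauge_coords k r x)) (simplex_height k (gauge_coords k r y)) * d x y
      else 0)"

end

theory Submission imports Defs begin

text \<open>
  Separating \<open>a i\<close> from \<open>a j\<close> by gauge-open sets means finding disjoint sublevel sets of \<open>r i\<close> and
  \<open>r j\<close>, that is, bounding \<open>max (r i) (r j)\<close> away from \<open>0\<close>. So the Hausdorff property forces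
  compatibility, and since metrizable spaces are Hausdorff, everything rests on the metric.

  The map \<open>gauge_coords\<close> sends \<open>X\<close> to the simplex, and the preimage of the \<open>i\<close>-th vertex is exactly
  \<open>{a i}\<close>. The metric measures the movement in the simplex and adds a copy of \<open>d\<close> shrunk by the height,
  which vanishes at the vertices. The triangle inequality could fail only if a detour passes through
  a point of small height, where \<open>d\<close>-distances are cheap. The lemma \<open>height_drop_le_detour\<close> excludes
  this: in the \<open>\<ell>\<^sup>1\<close> distance a detour through a point lower than both ends costs at least the
  height lost, and \<open>d \<le> 1\<close> makes this enough.

  Where the height is positive the new metric is locally equivalent to \<open>d\<close>, and the gauge condition
  imposes nothing at such points. The distance from \<open>a i\<close> to \<open>y\<close> is \<open>1 - gauge_coords k r y i\<close>. It is at least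
  \<open>r i y / 2\<close>, because \<open>r i\<close> times the \<open>i\<close>-th coordinate equals \<open>r j\<close> times the \<open>j\<close>-th coordinate.
  Hence gauge-open sets are metrically open. For the converse, compatibility keeps all \<open>r j\<close> with
  \<open>j \<noteq> i\<close> away from \<open>0\<close> where \<open>r i\<close> is small, so that the distance is at most a constant times
  \<open>r i y\<close>. The balls around \<open>a i\<close> and the sublevel sets of \<open>r i\<close> are then cofinal in one another.
\<close>

section \<open>Height and distance on the simplex\<close>

lemma simplex_dist_nonneg: "0 \<le> simplex_dist k p t"
  by (simp add: simplex_dist_def sum_nonneg)

lemma simplex_dist_commute: "simplex_dist k p t = simplex_dist k t p"
  by (simp add: simplex_dist_def abs_minus_commute)

lemma simplex_dist_triangle: "simplex_dist k p t \<le> simplex_dist k p q + simplex_dist k q t"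
  unfolding simplex_dist_def distrib_left [symmetric] sum.distrib [symmetric]
  by (intro mult_left_mono sum_mono) auto

lemma coord_diff_le_simplex_dist:
  assumes "i \<in> {1..k}"
  shows "\<bar>p i - t i\<bar> \<le> 2 * simplex_dist k p t"
  using member_le_sum [of i "{1..k}" "\<lambda>i. \<bar>p i - t i\<bar>"] assms by (simp add: simplex_dist_def)

lemma height_le:
  assumes "i \<in> {1..k}"
  shows "simplex_height k p \<le> 1 - p i"
  using assms by (auto simp: simplex_height_def intro!: Max_ge)

lemma height_attained:
  assumes "1 \<le> k"
  obtains i where "i \<in> {1..k}" "simplex_height k p = 1 - p i"
proof -
  have "Max (p ` {1..k}) \<in> p ` {1..k}"
    using assms by (intro Max_in) auto
  then obtain i where "i \<in> {1..k}" "Max (p ` {1..k}) = p i"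
    by (rule imageE) metis
  then show thesis
    using that by (metis simplex_height_def)
qed

lemma height_diff_le:
  assumes "1 \<le> k"
  shows "simplex_height k p - simplex_height k t \<le> 2 * simplex_dist k p t"
proof -
  obtain i where i: "i \<in> {1..k}" "simplex_height k t = 1 - t i"
    using height_attained [OF assms] .
  then show ?thesis
    using height_le [OF i(1), of p] coord_diff_le_simplex_dist [OF i(1), of p t] by linarith
qed

text \<open>
  The length of the detour from \<open>p\<close> to \<open>q\<close> through \<open>t\<close> exceeds the direct distance by the sum, over
  all coordinates, of the distance of \<open>t j\<close> from the interval between \<open>p j\<close> and \<open>q j\<close>. The coordinate
  in which \<open>t\<close> is largest alone accounts for the height lost.
\<close>

lemma height_drop_le_detour:
  assumes "1 \<le> k"
  shows "min (simplex_height k p) (simplex_height k q) - simplex_height k t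
    \<le> simplex_dist k p t + simplex_dist k t q - simplex_dist k p q"
proof -
  define e where "e j = 1/2 * (\<bar>p j - t j\<bar> + \<bar>t j - q j\<bar> - \<bar>p j - q j\<bar>)" for j
  obtain i where i: "i \<in> {1..k}" "simplex_height k t = 1 - t i"
    using height_attained [OF assms] .
  have "min (simplex_height k p) (simplex_height k q) - simplex_height k t \<le> t i - max (p i) (q i)"
    using i height_le [OF i(1), of p] height_le [OF i(1), of q] by linarith
  also have "\<dots> \<le> e i"
    by (auto simp: e_def max_def abs_if)
  also have "e i \<le> (\<Sum>j=1..k. e j)"
    using i by (intro member_le_sum) (auto simp: e_def)
  also have "\<dots> = simplex_dist k p t + simplex_dist k t q - simplex_dist k p q"
    by (simp add: e_def simplex_dist_def sum.distrib sum_subtractf flip: sum_distrib_left sum_divide_distrib)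
  finally show ?thesis .
qed

section \<open>Gauge coordinates\<close>

lemma topspace_gauge_topology: "topspace (gauge_topology X k a r) = topspace X"
proof
  show "topspace (gauge_topology X k a r) \<subseteq> topspace X"
    by (metis gauge_open_def openin_gauge_topology openin_subset openin_topspace)
  have "gauge_open X k a r (topspace X)"
    by (auto simp: gauge_open_def intro!: exI [of _ 1])
  then show "topspace X \<subseteq> topspace (gauge_topology X k a r)"
    by (simp add: openin_gauge_topology openin_subset)
qed

locale gauge_tuple =
  fixes X :: "'a topology" and k :: nat
    and a :: "nat \<Rightarrow> 'a" and r :: "nat \<Rightarrow> 'a \<Rightarrow> real"
  assumes k: "2 \<le> k"
    and a: "a ` {1..k} \<subseteq> topspace X"
    and inj: "inj_on a {1..k}"
    and cont: "\<And>i. i \<in> {1..k} \<Longrightarrow> continuous_map X (top_of_set {0..1}) (r i)"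
    and zero: "\<And>i. i \<in> {1..k} \<Longrightarrow> {x \<in> topspace X. r i x = 0} = {a i}"
begin

abbreviation "P \<equiv> gauge_prod k r"
abbreviation "u \<equiv> gauge_coords k r"
abbreviation "H x \<equiv> simplex_height k (u x)"

lemma r_range:
  assumes "i \<in> {1..k}" "x \<in> topspace X"
  shows "0 \<le> r i x" "r i x \<le> 1"
  using cont [OF assms(1)] assms(2) by (auto simp: continuous_map_def)

lemma r_eq_0_iff:
  assumes "i \<in> {1..k}" "x \<in> topspace X"
  shows "r i x = 0 \<longleftrightarrow> x = a i"
  using zero [OF assms(1)] assms(2) by auto

lemma gauge_prod_nonneg:
  assumes "x \<in> topspace X"
  shows "0 \<le> P i x"
  unfolding gauge_prod_def using assms r_range by (intro prod_nonneg) auto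

lemma gauge_prod_pos:
  assumes "x \<in> topspace X" "\<And>j. j \<in> {1..k} - {i} \<Longrightarrow> x \<noteq> a j"
  shows "0 < P i x"
  unfolding gauge_prod_def
proof (rule prod_pos)
  fix j assume "j \<in> {1..k} - {i}"
  then show "0 < r j x"
    using assms r_range(1) [of j x] r_eq_0_iff [of j x] by fastforce
qed

lemma sum_gauge_prod_pos:
  assumes "x \<in> topspace X"
  shows "0 < (\<Sum>l=1..k. P l x)"
proof -
  obtain i where i: "i \<in> {1..k}" "\<And>j. j \<in> {1..k} - {i} \<Longrightarrow> x \<noteq> a j"
  proof (cases "\<exists>i\<in>{1..k}. x = a i")
    case True
    then obtain i where i: "i \<in> {1..k}" "x = a i" by blast
    show ?thesis
      by (rule that [of i]) (use i inj in \<open>auto dest: inj_onD\<close>)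
  next
    case False
    show ?thesis
      by (rule that [of 1]) (use False k in auto)
  qed
  have "0 < P i x"
    using assms i(2) by (rule gauge_prod_pos)
  then show ?thesis
    using assms i(1) by (intro sum_pos2 [of "{1..k}" i]) (simp_all add: gauge_prod_nonneg)
qed

lemma coords_nonneg:
  assumes "x \<in> topspace X"
  shows "0 \<le> u x i"
  using gauge_prod_nonneg [OF assms, of i] sum_gauge_prod_pos [OF assms] by (simp add: gauge_coords_def)

lemma sum_coords:
  assumes "x \<in> topspace X"
  shows "(\<Sum>i=1..k. u x i) = 1"
  using sum_gauge_prod_pos [OF assms] by (simp add: gauge_coords_def flip: sum_divide_distrib)

lemma sum_other_coords:
  assumes "x \<in> topspace X" "i \<in> {1..k}"
  shows "(\<Sum>j\<in>{1..k} - {i}. u x j) = 1 - u x i"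
  using sum_coords [OF assms(1)] assms(2) by (simp add: sum_diff1)

lemma coords_le_1:
  assumes "x \<in> topspace X" "i \<in> {1..k}"
  shows "u x i \<le> 1"
  using sum_other_coords [OF assms] sum_nonneg [of "{1..k} - {i}" "u x"] coords_nonneg [OF assms(1)]
  by auto

lemma height_range:
  assumes "x \<in> topspace X"
  shows "0 \<le> H x" "H x \<le> 1"
proof -
  obtain i where "i \<in> {1..k}" "H x = 1 - u x i"
    using height_attained [of k] k by auto
  then show "0 \<le> H x" "H x \<le> 1"
    using assms coords_nonneg coords_le_1 by auto
qed

lemma coords_vertex:
  assumes "i \<in> {1..k}" "j \<in> {1..k}"
  shows "u (a i) j = (if j = i then 1 else 0)"
proof -
  have x: "a i \<in> topspace X"
    using a assms by auto
  have other: "u (a i) l = 0" if "l \<in> {1..k} - {i}" for l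
  proof -
    have "r i (a i) = 0"
      using r_eq_0_iff assms x by blast
    then have "P l (a i) = 0"
      using that assms unfolding gauge_prod_def by (intro prod_zero) auto
    then show ?thesis
      by (simp add: gauge_coords_def)
  qed
  show ?thesis
    using other sum_other_coords [OF x assms(1)] assms(2) by (auto simp: sum.neutral)
qed

text \<open>
  Both \<open>r i * P i\<close> and \<open>r j * P j\<close> are the product of all the gauges, so \<open>r i\<close> times the \<open>i\<close>-th
  coordinate is at most the \<open>j\<close>-th one, for any \<open>j \<noteq> i\<close>.
\<close>

lemma gauge_le_coord_defect:
  assumes "x \<in> topspace X" "i \<in> {1..k}"
  shows "r i x \<le> 2 * (1 - u x i)"
proof -
  obtain j where j: "j \<in> {1..k} - {i}"
  proof
    show "(if i = 1 then 2 else 1) \<in> {1..k} - {i}"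
      using k assms(2) by auto
  qed
  have full: "r l x * P l x = (\<Prod>m=1..k. r m x)" if "l \<in> {1..k}" for l
    using that by (simp add: gauge_prod_def prod.remove)
  have "r i x * P i x = r j x * P j x"
    using full assms(2) j by auto
  also have "\<dots> \<le> 1 * P j x"
    using j r_range assms gauge_prod_nonneg by (intro mult_right_mono) auto
  finally have "r i x * u x i \<le> u x j"
    using sum_gauge_prod_pos [OF assms(1)] by (simp add: gauge_coords_def divide_right_mono)
  also have "u x j \<le> (\<Sum>l\<in>{1..k} - {i}. u x l)"
    using j coords_nonneg [OF assms(1)] by (intro member_le_sum) auto
  also have "\<dots> = 1 - u x i"
    using assms by (rule sum_other_coords)
  finally have "r i x * u x i \<le> 1 - u x i" .
  moreover have "r i x * (1 - u x i) \<le> 1 * (1 - u x i)"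
    using r_range(2) coords_le_1 assms by (intro mult_right_mono) auto
  ultimately show ?thesis
    by (simp add: algebra_simps)
qed

lemma vertex_iff:
  assumes "x \<in> topspace X" "i \<in> {1..k}"
  shows "u x i = 1 \<longleftrightarrow> x = a i"
  using gauge_le_coord_defect [OF assms] r_range(1) [OF assms(2,1)] r_eq_0_iff [OF assms(2,1)]
    coords_vertex assms(2) by auto

lemma height_eq_0E:
  assumes "x \<in> topspace X" "H x = 0"
  obtains i where "i \<in> {1..k}" "u x i = 1"
proof -
  obtain i where "i \<in> {1..k}" "H x = 1 - u x i"
    using height_attained [of k] k by auto
  then show thesis
    using that assms by auto
qed

lemma height_vertex:
  assumes "i \<in> {1..k}"
  shows "H (a i) = 0"
  using height_le [OF assms, of "u (a i)"] height_range(1) [of "a i"] coords_vertex [OF assms assms]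
    a assms by fastforce

lemma simplex_dist_vertex:
  assumes "i \<in> {1..k}" "y \<in> topspace X"
  shows "simplex_dist k (u (a i)) (u y) = 1 - u y i"
proof -
  have "(\<Sum>j=1..k. \<bar>u (a i) j - u y j\<bar>)
      = \<bar>u (a i) i - u y i\<bar> + (\<Sum>j\<in>{1..k} - {i}. \<bar>u (a i) j - u y j\<bar>)"
    using assms by (simp add: sum.remove)
  also have "(\<Sum>j\<in>{1..k} - {i}. \<bar>u (a i) j - u y j\<bar>) = (\<Sum>j\<in>{1..k} - {i}. u y j)"
    using assms coords_nonneg by (intro sum.cong) (auto simp: coords_vertex)
  also have "\<dots> = 1 - u y i"
    using assms by (intro sum_other_coords)
  also have "\<bar>u (a i) i - u y i\<bar> = 1 - u y i"
    using assms coords_le_1 by (simp add: coords_vertex)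
  finally show ?thesis
    by (simp add: simplex_dist_def)
qed

lemma continuous_coords:
  assumes "i \<in> {1..k}"
  shows "continuous_map X euclideanreal (\<lambda>x. u x i)"
proof -
  have r: "continuous_map X euclideanreal (r j)" if "j \<in> {1..k}" for j
    using cont [OF that] continuous_map_into_fulltopology by blast
  then have "continuous_map X euclideanreal (P l)" for l
    unfolding gauge_prod_def by (intro continuous_map_prod) auto
  then show ?thesis
    unfolding gauge_coords_def using sum_gauge_prod_pos
    by (intro continuous_map_real_divide continuous_map_sum) (auto simp: less_imp_neq [symmetric])
qed

lemma continuous_simplex_dist: "continuous_map X euclideanreal (\<lambda>y. simplex_dist k (u x) (u y))"
  unfolding simplex_dist_def
  by (intro continuous_map_real_mult continuous_map_sum continuous_map_real_abs
      continuous_map_diff continuous_coords) auto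

section \<open>Compatibility\<close>

lemma max_gauge_nonneg:
  assumes "i \<in> {1..k}" "x \<in> topspace X"
  shows "0 \<le> max (r i x) (r j x)"
  using r_range(1) [OF assms] by simp

lemma Hausdorff_imp_compatible:
  assumes "Hausdorff_space (gauge_topology X k a r)"
  shows "gauge_compatible X k r"
  unfolding gauge_compatible_def
proof (intro ballI impI)
  fix i j assume ij: "i \<in> {1..k}" "j \<in> {1..k}" "i \<noteq> j"
  have points: "a i \<in> topspace X" "a j \<in> topspace X" "a i \<noteq> a j"
    using a ij inj_onD [OF inj] by blast+
  have "\<exists>U V. gauge_open X k a r U \<and> gauge_open X k a r V \<and> a i \<in> U \<and> a j \<in> V \<and> disjnt U V"
    using assms points unfolding Hausdorff_space_def topspace_gauge_topology openin_gauge_topology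
    by simp
  then obtain U V where UV: "gauge_open X k a r U" "gauge_open X k a r V" "a i \<in> U" "a j \<in> V"
      "disjnt U V"
    by blast
  obtain e where e: "e > 0" "{x \<in> topspace X. r i x < e} \<subseteq> U"
    using UV ij unfolding gauge_open_def by blast
  obtain e' where e': "e' > 0" "{x \<in> topspace X. r j x < e'} \<subseteq> V"
    using UV ij unfolding gauge_open_def by blast
  have "min e e' \<le> max (r i x) (r j x)" if "x \<in> topspace X" for x
  proof (rule ccontr)
    assume "\<not> ?thesis"
    then have "x \<in> U" "x \<in> V"
      using that e(2) e'(2) by auto
    then show False
      using UV(5) by (auto simp: disjnt_iff)
  qed
  then have "min e e' \<le> (INF x\<in>topspace X. max (r i x) (r j x))"
    using points(1) by (intro cINF_greatest) blast+
  then show "0 < (INF x\<in>topspace X. max (r i x) (r j x))"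
    using e(1) e'(1) by linarith
qed

lemma compatible_uniform_bound:
  assumes "gauge_compatible X k r" "i \<in> {1..k}"
  obtains c where "0 < c"
    "\<And>j x. \<lbrakk>j \<in> {1..k} - {i}; x \<in> topspace X\<rbrakk> \<Longrightarrow> c \<le> max (r i x) (r j x)"
proof -
  define m where "m j = (INF x\<in>topspace X. max (r i x) (r j x))" for j
  define c where "c = Min (insert 1 (m ` ({1..k} - {i})))"
  have "0 < m j" if "j \<in> {1..k} - {i}" for j
    using assms that unfolding gauge_compatible_def m_def by auto
  then have "0 < c"
    unfolding c_def by (subst Min_gr_iff) auto
  moreover have "c \<le> max (r i x) (r j x)" if "j \<in> {1..k} - {i}" "x \<in> topspace X" for j x
  proof -
    have "c \<le> m j"
      unfolding c_def using that by (intro Min_le) auto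
    also have "m j \<le> max (r i x) (r j x)"
      unfolding m_def using that max_gauge_nonneg [OF assms(2)]
      by (intro cINF_lower bdd_belowI2 [of _ 0]) auto
    finally show ?thesis .
  qed
  ultimately show thesis
    using that by blast
qed

text \<open>
  Where \<open>r i < c\<close>, all other gauges are at least \<open>c\<close>. So \<open>P i\<close> is bounded below, whereas every
  other \<open>P j\<close> contains the factor \<open>r i\<close>.
\<close>

lemma compatible_coord_defect_le:
  assumes "gauge_compatible X k r" "i \<in> {1..k}"
  obtains c C where "0 < c" "0 < C"
    "\<And>x. \<lbrakk>x \<in> topspace X; r i x < c\<rbrakk> \<Longrightarrow> 1 - u x i \<le> C * r i x"
proof -
  obtain c where c: "0 < c"
      "\<And>j x. \<lbrakk>j \<in> {1..k} - {i}; x \<in> topspace X\<rbrakk> \<Longrightarrow> c \<le> max (r i x) (r j x)"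
    using compatible_uniform_bound [OF assms] by blast
  have "1 - u x i \<le> real k / c ^ (k - 1) * r i x" if x: "x \<in> topspace X" and small: "r i x < c" for x
  proof -
    have "c ^ (k - 1) = (\<Prod>j\<in>{1..k} - {i}. c)"
      using assms(2) by simp
    also have "\<dots> \<le> P i x"
      unfolding gauge_prod_def using c(1) c(2) [OF _ x] small by (intro prod_mono) fastforce
    also have "\<dots> \<le> (\<Sum>l=1..k. P l x)"
      using assms(2) gauge_prod_nonneg [OF x] by (intro member_le_sum) auto
    finally have total: "c ^ (k - 1) \<le> (\<Sum>l=1..k. P l x)" .
    have "u x j \<le> r i x / c ^ (k - 1)" if j: "j \<in> {1..k} - {i}" for j
    proof -
      have "P j x = r i x * (\<Prod>l\<in>{1..k} - {j} - {i}. r l x)"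
        unfolding gauge_prod_def using assms(2) j by (intro prod.remove) auto
      also have "\<dots> \<le> r i x * 1"
        using r_range x assms(2) by (intro mult_left_mono prod_le_1) auto
      finally show ?thesis
        unfolding gauge_coords_def using total c(1) r_range(1) [OF assms(2) x] by (intro frac_le) auto
    qed
    then have "(\<Sum>j\<in>{1..k} - {i}. u x j) \<le> real (card ({1..k} - {i})) * (r i x / c ^ (k - 1))"
      by (intro sum_bounded_above)
    also have "\<dots> \<le> real k * (r i x / c ^ (k - 1))"
      using assms(2) c(1) r_range(1) [OF assms(2) x] by (intro mult_right_mono) auto
    finally show ?thesis
      unfolding sum_other_coords [OF x assms(2)] by simp
  qed
  moreover have "0 < real k / c ^ (k - 1)"
    using c(1) k by simp
  ultimately show thesis
    using that c(1) by blast
qed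

end

section \<open>The metric\<close>

locale gauge_tuple_metric = gauge_tuple X k a r + Metric_space "topspace X" d
  for X :: "'a topology" and k :: nat and a :: "nat \<Rightarrow> 'a" and r :: "nat \<Rightarrow> 'a \<Rightarrow> real"
    and d :: "'a \<Rightarrow> 'a \<Rightarrow> real" +
  assumes d_le_1: "\<And>x y. \<lbrakk>x \<in> topspace X; y \<in> topspace X\<rbrakk> \<Longrightarrow> d x y \<le> 1"
    and mtopology_d: "mtopology = X"
begin

abbreviation "\<rho> \<equiv> gauge_metric X k r d"

lemma gauge_metric_eq:
  assumes "x \<in> topspace X" "y \<in> topspace X"
  shows "\<rho> x y = simplex_dist k (u x) (u y) + min (H x) (H y) * d x y"
  using assms by (simp add: gauge_metric_def)

lemma simplex_dist_le_gauge_metric: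
  assumes "x \<in> topspace X" "y \<in> topspace X"
  shows "simplex_dist k (u x) (u y) \<le> \<rho> x y"
  using height_range assms by (simp add: gauge_metric_eq)

lemma gauge_metric_le:
  assumes "x \<in> topspace X" "y \<in> topspace X"
  shows "\<rho> x y \<le> simplex_dist k (u x) (u y) + d x y"
proof -
  have "min (H x) (H y) * d x y \<le> 1 * d x y"
    using height_range(2) [OF assms(1)] by (intro mult_right_mono) auto
  then show ?thesis
    using assms by (simp add: gauge_metric_eq)
qed

lemma gauge_metric_vertex:
  assumes "i \<in> {1..k}" "y \<in> topspace X"
  shows "\<rho> (a i) y = 1 - u y i"
proof -
  have "a i \<in> topspace X"
    using a assms by auto
  moreover have "min (H (a i)) (H y) = 0"
    using height_vertex [OF assms(1)] height_range(1) [OF assms(2)] by simp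
  ultimately show ?thesis
    using assms simplex_dist_vertex by (simp add: gauge_metric_eq)
qed

lemma gauge_metric_zero_iff:
  assumes x: "x \<in> topspace X" and y: "y \<in> topspace X"
  shows "\<rho> x y = 0 \<longleftrightarrow> x = y"
proof
  assume "x = y"
  then show "\<rho> x y = 0"
    using x by (simp add: gauge_metric_eq simplex_dist_def)
next
  assume 0: "\<rho> x y = 0"
  have dist: "simplex_dist k (u x) (u y) = 0"
    using simplex_dist_le_gauge_metric [OF x y] simplex_dist_nonneg [of k "u x" "u y"] 0 by simp
  have eq: "u x i = u y i" if "i \<in> {1..k}" for i
    using coord_diff_le_simplex_dist [OF that, of "u x" "u y"] dist by simp
  have "min (H x) (H y) * d x y = 0"
    using 0 dist gauge_metric_eq [OF x y] by simp
  then consider "H x = 0" | "H y = 0" | "d x y = 0"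
    by (auto simp: min_def split: if_splits)
  then show "x = y"
  proof cases
    case 1
    then obtain i where "i \<in> {1..k}" "u x i = 1"
      using height_eq_0E x by blast
    then show ?thesis
      using eq vertex_iff x y by metis
  next
    case 2
    then obtain i where "i \<in> {1..k}" "u y i = 1"
      using height_eq_0E y by blast
    then show ?thesis
      using eq vertex_iff x y by metis
  next
    case 3
    then show ?thesis
      using x y by simp
  qed
qed

lemma gauge_metric_triangle:
  assumes x: "x \<in> topspace X" and y: "y \<in> topspace X" and z: "z \<in> topspace X"
  shows "\<rho> x z \<le> \<rho> x y + \<rho> y z"
proof -
  define m where "m = min (H x) (H z)"
  have m: "0 \<le> m"
    unfolding m_def using height_range x z by auto
  have xz: "\<rho> x z = simplex_dist k (u x) (u z) + m * d x z"
    using gauge_metric_eq x z by (simp add: m_def)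
  have tri: "d x z \<le> d x y + d y z"
    using triangle x y z by blast
  show ?thesis
  proof (cases "m \<le> H y")
    case True
    have "m * d x z \<le> m * d x y + m * d y z"
      using mult_left_mono [OF tri m] by (simp add: distrib_left)
    also have "\<dots> \<le> min (H x) (H y) * d x y + min (H y) (H z) * d y z"
      using True by (intro add_mono mult_right_mono) (auto simp: m_def)
    finally show ?thesis
      using simplex_dist_triangle [of k "u x" "u z" "u y"] gauge_metric_eq [OF x y]
        gauge_metric_eq [OF y z] xz by linarith
  next
    case False
    \<comment> \<open>Only the weight \<open>H y\<close> is available on the detour; the missing \<open>m - H y\<close> is paid for by the
      excess length in the simplex.\<close>
    have "m * d x z = H y * d x z + (m - H y) * d x z"
      by (simp add: algebra_simps)
    also have "\<dots> \<le> H y * (d x y + d y z) + (m - H y) * 1"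
      using False tri d_le_1 x y z height_range by (intro add_mono mult_left_mono) auto
    also have "m - H y \<le> simplex_dist k (u x) (u y) + simplex_dist k (u y) (u z) - simplex_dist k (u x) (u z)"
      unfolding m_def using k by (intro height_drop_le_detour) simp
    finally have "\<rho> x z \<le> simplex_dist k (u x) (u y) + simplex_dist k (u y) (u z) + H y * (d x y + d y z)"
      using xz by simp
    moreover have "min (H x) (H y) = H y" "min (H y) (H z) = H y"
      using False by (auto simp: m_def)
    ultimately show ?thesis
      using gauge_metric_eq x y z by (simp add: distrib_left)
  qed
qed

lemma Metric_space_gauge_metric: "Metric_space (topspace X) \<rho>"
proof
  show "0 \<le> \<rho> x y" for x y
    using simplex_dist_nonneg height_range by (auto simp: gauge_metric_def)
  show "\<rho> x y = \<rho> y x" for x y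
    by (simp add: gauge_metric_def simplex_dist_commute min.commute commute)
qed (use gauge_metric_zero_iff gauge_metric_triangle in auto)

sublocale G: Metric_space "topspace X" \<rho>
  by (rule Metric_space_gauge_metric)

text \<open>
  At a point of \<open>a ` {1..k}\<close> the gauge condition itself provides a ball, since the distance to \<open>y\<close>
  bounds \<open>r i y\<close>. At any other point \<open>x\<close>, the height stays above half its value at \<open>x\<close> in a small enough
  neighbourhood, and there \<open>d\<close> is controlled by the new metric.
\<close>

lemma gauge_open_imp_metric_open:
  assumes "gauge_open X k a r U"
  shows "openin G.mtopology U"
  unfolding G.openin_mtopology
proof (intro conjI allI impI)
  show sub: "U \<subseteq> topspace X"
    using assms openin_subset unfolding gauge_open_def by blast
  fix x assume "x \<in> U"
  then have x: "x \<in> topspace X"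
    using sub by blast
  show "\<exists>e>0. G.mball x e \<subseteq> U"
  proof (cases "\<exists>i\<in>{1..k}. x = a i")
    case True
    then obtain i where i: "i \<in> {1..k}" "x = a i" by blast
    then obtain e where e: "e > 0" "{y \<in> topspace X. r i y < e} \<subseteq> U"
      using assms \<open>x \<in> U\<close> unfolding gauge_open_def by blast
    have "G.mball x (e/2) \<subseteq> {y \<in> topspace X. r i y < e}"
    proof
      fix y assume "y \<in> G.mball x (e/2)"
      then have y: "y \<in> topspace X" "\<rho> (a i) y < e/2"
        using i by auto
      then show "y \<in> {y \<in> topspace X. r i y < e}"
        using gauge_le_coord_defect [OF y(1) i(1)] gauge_metric_vertex [OF i(1) y(1)] by simp
    qed
    then show ?thesis
      using e by (intro exI [of _ "e/2"]) auto
  next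
    case False
    then have "H x \<noteq> 0"
      using height_eq_0E [OF x] vertex_iff [OF x] by metis
    then have h: "0 < H x"
      using height_range(1) [OF x] by simp
    obtain e where e: "e > 0" "mball x e \<subseteq> U"
      using assms \<open>x \<in> U\<close> mtopology_d openin_mtopology unfolding gauge_open_def by metis
    \<comment> \<open>The height varies by at most twice the distance in the simplex, so the first bound keeps it
      above \<open>H x / 2\<close>; the second then turns into \<open>d x y < e\<close>.\<close>
    define \<delta> where "\<delta> = min (H x / 4) (e * (H x / 2))"
    have "G.mball x \<delta> \<subseteq> mball x e"
    proof
      fix y assume "y \<in> G.mball x \<delta>"
      then have y: "y \<in> topspace X" and close: "\<rho> x y < \<delta>"
        by auto
      have "simplex_dist k (u x) (u y) < H x / 4"
        using simplex_dist_le_gauge_metric [OF x y] close by (simp add: \<delta>_def)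
      then have "H x / 2 \<le> min (H x) (H y)"
        using height_diff_le [of k "u x" "u y"] k h by simp
      then have "H x / 2 * d x y \<le> min (H x) (H y) * d x y"
        by (rule mult_right_mono) simp
      also have "\<dots> \<le> \<rho> x y"
        using gauge_metric_eq [OF x y] simplex_dist_nonneg [of k "u x" "u y"] by simp
      also have "\<dots> < H x / 2 * e"
        using close by (simp add: \<delta>_def mult.commute)
      finally have "d x y < e"
        using h by simp
      then show "y \<in> mball x e"
        using x y by simp
    qed
    moreover have "0 < \<delta>"
      using h e by (simp add: \<delta>_def)
    ultimately show ?thesis
      using e by blast
  qed
qed

lemma metric_open_imp_open:
  assumes "openin G.mtopology V"
  shows "openin X V"
proof (subst openin_subopen, intro ballI)
  fix x assume "x \<in> V"
  then obtain e where e: "e > 0" "G.mball x e \<subseteq> V" and x: "x \<in> topspace X"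
    using assms unfolding G.openin_mtopology by blast
  define N where "N = {y \<in> topspace X. simplex_dist k (u x) (u y) \<in> {..<e/2}} \<inter> mball x (e/2)"
  have "openin X {y \<in> topspace X. simplex_dist k (u x) (u y) \<in> {..<e/2}}"
    by (rule openin_continuous_map_preimage [OF continuous_simplex_dist]) simp
  moreover have "openin X (mball x (e/2))"
    using openin_mball mtopology_d by metis
  ultimately have "openin X N"
    unfolding N_def by (rule openin_Int)
  moreover have "x \<in> N"
    using x e by (simp add: N_def simplex_dist_def)
  moreover have "N \<subseteq> G.mball x e"
    using gauge_metric_le [OF x] x by (fastforce simp: N_def)
  ultimately show "\<exists>T. openin X T \<and> x \<in> T \<and> T \<subseteq> V"
    using e by blast
qed

lemma mtopology_gauge_metric:
  assumes "gauge_compatible X k r"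
  shows "G.mtopology = gauge_topology X k a r"
proof -
  have "gauge_open X k a r V" if V: "openin G.mtopology V" for V
    unfolding gauge_open_def
  proof (intro conjI ballI impI)
    show "openin X V"
      using V by (rule metric_open_imp_open)
    fix i assume i: "i \<in> {1..k}" "a i \<in> V"
    obtain e where e: "e > 0" "G.mball (a i) e \<subseteq> V"
      using V i unfolding G.openin_mtopology by blast
    obtain c C where c: "0 < c" "0 < C"
        "\<And>x. \<lbrakk>x \<in> topspace X; r i x < c\<rbrakk> \<Longrightarrow> 1 - u x i \<le> C * r i x"
      using compatible_coord_defect_le [OF assms i(1)] by blast
    have "{x \<in> topspace X. r i x < min c (e / C)} \<subseteq> G.mball (a i) e"
    proof
      fix x assume "x \<in> {x \<in> topspace X. r i x < min c (e / C)}"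
      then have x: "x \<in> topspace X" "r i x < c" "C * r i x < e"
        using c(2) by (auto simp: field_simps)
      then show "x \<in> G.mball (a i) e"
        using c(3) [OF x(1,2)] gauge_metric_vertex [OF i(1) x(1)] a i by auto
    qed
    then show "\<exists>\<epsilon>>0. {x \<in> topspace X. r i x < \<epsilon>} \<subseteq> V"
      using c e by (intro exI [of _ "min c (e / C)"]) auto
  qed
  then show ?thesis
    unfolding topology_eq openin_gauge_topology using gauge_open_imp_metric_open by blast
qed

end

lemma metrizable_space_bounded_metric:
  assumes "metrizable_space X"
  obtains d where "Metric_space (topspace X) d" "\<And>x y. d x y \<le> (1::real)"
    "Metric_space.mtopology (topspace X) d = X"
proof -
  obtain M d where M: "Metric_space M d" and X: "X = Metric_space.mtopology M d"
    using assms unfolding metrizable_space_def by blast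
  interpret Metric_space M d by (rule M)
  have "topspace X = M"
    using X by simp
  moreover have "capped_dist 1 x y \<le> 1" for x y
    by (simp add: capped_dist_def)
  ultimately show thesis
    using that [of "capped_dist 1"] capped_dist X mtopology_capped_metric [of 1]
    by simp
qed

theorem corollary3p5:
  fixes X :: "'a topology" and k :: nat
    and a :: "nat \<Rightarrow> 'a" and r :: "nat \<Rightarrow> 'a \<Rightarrow> real"
  assumes "metrizable_space X"
    and "2 \<le> k"
    and "a ` {1..k} \<subseteq> topspace X"
    and "inj_on a {1..k}"
    and "\<And>i. i \<in> {1..k} \<Longrightarrow> continuous_map X (top_of_set {0..1}) (r i)"
    and "\<And>i. i \<in> {1..k} \<Longrightarrow> {x \<in> topspace X. r i x = 0} = {a i}"
  shows "(gauge_compatible X k r \<longleftrightarrow> Hausdorff_space (gauge_topology X k a r)) \<and>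
         (Hausdorff_space (gauge_topology X k a r) \<longleftrightarrow> metrizable_space (gauge_topology X k a r)) \<and>
         (gauge_compatible X k r \<longrightarrow>
           (\<forall>d. Metric_space (topspace X) d \<and>
                (\<forall>x\<in>topspace X. \<forall>y\<in>topspace X. d x y \<le> 1) \<and>
                Metric_space.mtopology (topspace X) d = X \<longrightarrow>
                Metric_space (topspace X) (gauge_metric X k r d) \<and>
                Metric_space.mtopology (topspace X) (gauge_metric X k r d) = gauge_topology X k a r))"

proof -
  interpret gauge_tuple X k a r
    using assms(2-6) by unfold_locales
  have metric: "Metric_space (topspace X) (gauge_metric X k r d) \<and>
      Metric_space.mtopology (topspace X) (gauge_metric X k r d) = gauge_topology X k a r"
    if "gauge_compatible X k r" "Metric_space (topspace X) d"
      "\<forall>x\<in>topspace X. \<forall>y\<in>topspace X. d x y \<le> 1" "Metric_space.mtopology (topspace X) d = X" for d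
  proof -
    interpret Metric_space "topspace X" d by (rule that(2))
    interpret gauge_tuple_metric X k a r d
      using that(3,4) by unfold_locales auto
    show ?thesis
      using Metric_space_gauge_metric mtopology_gauge_metric [OF that(1)] by blast
  qed
  have "metrizable_space (gauge_topology X k a r)" if compat: "gauge_compatible X k r"
  proof -
    obtain d where "Metric_space (topspace X) d" "\<And>x y. d x y \<le> (1::real)"
        "Metric_space.mtopology (topspace X) d = X"
      using metrizable_space_bounded_metric [OF assms(1)] by blast
    then show ?thesis
      using metric [OF compat] unfolding metrizable_space_def by metis
  qed
  then show ?thesis
    using metric Hausdorff_imp_compatible metrizable_imp_Hausdorff_space by blast
qed

end
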